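(* Let $d\ge 0$ be an integer, let $\Omega\subset\mathbb{R}^{d+1}$ be a bounded open set with boundary of class $\mathcal{C}^1$, and let $H:\mathbb{R}^{d+1}\to\mathbb{R}$ be continuous, coercive and quasi-convex. Let $u:\bar\Omega\to\mathbb{R}$ be locally bounded and such that its upper semi-continuous envelope satisfies $$u^*(x)=\limsup_{y\to x,\ y\in\Omega}u^*(y)\qquad\text{for all }x\in\partial\Omega .$$ Then $u$ is a viscosity solution of the state constraint problem $$\left\{\begin{array}{ll} u+H(\nabla u)\ge 0 & \text{in }\bar\Omega,\\ u+H(\nabla u)\le 0 & \text{in }\Omega\end{array}\right.$$ if and only if $u$ is a viscosity solution of the flux-limited problem $$\left\{\begin{array}{ll} u+H(\nabla u)=0 & \text{in }\Omega,\\ u+H^-(\nabla u)=0 & \text{on }\partial\Omega,\end{array}\right.$$ where $H^-$ is the nonincreasing part of $H$ along the inward normal vector.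
   Context: Assumptions on $H$: coercive means $\lim_{|p|\to+\infty}H(p)=+\infty$; quasi-convex means that $\{p: H(p)\le\lambda\}$ is convex for every $\lambda\in\mathbb{R}$. Nonincreasing part. For $x\in\partial\Omega$ let $N_x$ be the inward unit normal. For $p\in\mathbb{R}^{d+1}$ let $p_N=p\cdot N_x\in\mathbb{R}$ and let $p'=p-p_NN_x$ be the tangential component, an element of the tangent hyperplane $N_x^\perp\cong\mathbb{R}^d$; write $p=(p',p_N)$ and $H_x(p',p_N)=H(p'+p_NN_x)$. Let $\pi^0(p')$ be a point with $\min_{p_N\in\mathbb{R}}H_x(p',p_N)=H_x(p',\pi^0(p'))$. Define $H_x^-(p',p_N)=H_x(p',p_N)$ if $p_N\le\pi^0(p')$ and $H_x^-(p',p_N)=H_x(p',\pi^0(p'))$ otherwise. This does not depend on the choice of minimizer. At a boundary point $x$, $H^-$ means $H^-_x$. Envelopes: $u^*(x)=\limsup_{y\to x}u(y)$ and $u_*(x)=\liminf_{y\to x}u(y)$, with $y\in\bar\Omega$ (the point $x$ itself is allowed). Viscosity sense. Test functions are $\varphi\in\mathcal{C}^1(\bar\Omega)$. $\varphi$ touches $u^*$ from above (resp. $u_*$ from below) at $x_0\in\bar\Omega$ if $u^*\le\varphi$ (resp. $u_*\ge\varphi$) in a neighborhood of $x_0$ in $\bar\Omega$, with equality at $x_0$. For $G\in\{H,H^-\}$, "$u+G(\nabla u)\le0$ (resp. $\ge 0$) on a set $S\subset\bar\Omega$" means: for every test function $\varphi$ touching $u^*$ from above (resp. $u_*$ from below)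 at a point $x_0\in S$, one has $\varphi(x_0)+G(\nabla\varphi(x_0))\le 0$ (resp. $\ge0$). Equality "$=0$" on $S$ means that both inequalities hold on $S$. A viscosity solution of a system satisfies all its lines in this sense. (The weak continuity condition on $u^*$ at the boundary displayed in the claim is also part of the definition of a flux-limited solution.) *)

theory Defs
  imports "HOL-Analysis.Analysis"
begin

text \<open>
  The ambient space, of dimension \<open>d + 1\<close> with \<open>d \<ge> 0\<close>, is an arbitrary type of class
  \<open>euclidean_space\<close>. Functions on the closure of \<open>\<Omega>\<close> are total functions
  whose values outside the closure are never used.
\<close>

section \<open>Domains with boundary of class C1\<close>

text \<open>
  \<open>g\<close> is a gradient of \<open>f\<close> on \<open>S\<close>, continuous up to the points of \<open>S\<close>. For
  \<open>S = UNIV\<close> this is the usual notion of a C1 function. For \<open>S = closure \<Omega>\<close>, where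
  \<open>\<Omega>\<close> has C1 boundary, it says that \<open>f\<close> is C1 in \<open>\<Omega>\<close> and that \<open>f\<close> and its
  gradient extend continuously to the closure; the gradient \<open>g\<close> is then determined by \<open>f\<close>
  at every point of the closure, boundary points included.
\<close>

definition C1_with_gradient ::
  "'a::euclidean_space set \<Rightarrow> ('a \<Rightarrow> real) \<Rightarrow> ('a \<Rightarrow> 'a) \<Rightarrow> bool" where
  "C1_with_gradient S f g \<longleftrightarrow>
     continuous_on S g \<and>
     (\<forall>x\<in>S. (f has_derivative (\<lambda>h. h \<bullet> g x)) (at x within S))"

definition tangential :: "'a::euclidean_space \<Rightarrow> 'a \<Rightarrow> 'a" where
  "tangential n p = p - (p \<bullet> n) *\<^sub>R n"

text \<open>
  Near \<open>x\<close>, \<open>\<Omega>\<close> is the strict epigraph, in the direction \<open>\<nu>\<close>, of the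
  C1 function \<open>\<gamma>\<close> of the coordinates orthogonal to \<open>\<nu>\<close>. The function \<open>\<gamma>\<close>
  lives on the whole space instead of the hyperplane orthogonal to \<open>\<nu>\<close>, but only its values on
  that hyperplane matter.
\<close>

definition C1_graph_chart ::
  "'a::euclidean_space set \<Rightarrow> 'a \<Rightarrow> real \<Rightarrow> 'a \<Rightarrow> ('a \<Rightarrow> real) \<Rightarrow> bool" where
  "C1_graph_chart \<Omega> x r \<nu> \<gamma> \<longleftrightarrow>
     r > 0 \<and> norm \<nu> = 1 \<and> (\<exists>g. C1_with_gradient UNIV \<gamma> g) \<and>
     \<Omega> \<inter> ball x r = {y \<in> ball x r. \<gamma> (tangential \<nu> y) < y \<bullet> \<nu>}"

definition C1_boundary :: "'a::euclidean_space set \<Rightarrow> bool" where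
  "C1_boundary \<Omega> \<longleftrightarrow> (\<forall>x\<in>frontier \<Omega>. \<exists>r \<nu> \<gamma>. C1_graph_chart \<Omega> x r \<nu> \<gamma>)"

text \<open>
  The inward normal points in the direction of the gradient of the local defining function
  \<open>y \<mapsto> y \<bullet> \<nu> - \<gamma> (tangential \<nu> y)\<close>, which is positive exactly in \<open>\<Omega>\<close>.
\<close>

definition is_inward_unit_normal :: "'a::euclidean_space set \<Rightarrow> 'a \<Rightarrow> 'a \<Rightarrow> bool" where
  "is_inward_unit_normal \<Omega> x n \<longleftrightarrow>
     norm n = 1 \<and>
     (\<exists>r \<nu> \<gamma> c. C1_graph_chart \<Omega> x r \<nu> \<gamma> \<and> c > 0 \<and>
        ((\<lambda>y. y \<bullet> \<nu> - \<gamma> (tangential \<nu> y)) has_derivative (\<lambda>h. h \<bullet> (c *\<^sub>R n))) (at x))"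

definition inward_unit_normal :: "'a::euclidean_space set \<Rightarrow> 'a \<Rightarrow> 'a" where
  "inward_unit_normal \<Omega> x = (THE n. is_inward_unit_normal \<Omega> x n)"

lemma C1_graph_chart_frontier:
  assumes "C1_graph_chart \<Omega> x r \<nu> \<gamma>" "x \<in> frontier \<Omega>"
  shows "\<gamma> (tangential \<nu> x) = x \<bullet> \<nu>"
proof -
  let ?\<rho> = "\<lambda>y. y \<bullet> \<nu> - \<gamma> (tangential \<nu> y)"
  from assms(1) obtain g where r: "r > 0" and g: "C1_with_gradient UNIV \<gamma> g"
    and eq: "\<Omega> \<inter> ball x r = {y \<in> ball x r. \<gamma> (tangential \<nu> y) < y \<bullet> \<nu>}"
    unfolding C1_graph_chart_def by blast
  have mem: "y \<in> \<Omega> \<longleftrightarrow> ?\<rho> y > 0" if "y \<in> ball x r" for y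
    using eq that by (auto simp: set_eq_iff)
  have "continuous_on UNIV \<gamma>"
    using g unfolding C1_with_gradient_def by (intro has_derivative_continuous_on[of UNIV \<gamma> "\<lambda>x h. h \<bullet> g x"]) simp
  moreover have "continuous_on UNIV (tangential \<nu>)"
    unfolding tangential_def by (intro continuous_intros)
  ultimately have "continuous_on UNIV (\<lambda>y. \<gamma> (tangential \<nu> y))"
    by (rule continuous_on_compose2) simp
  then have "continuous_on UNIV ?\<rho>"
    by (intro continuous_intros)
  then have cont: "(?\<rho> \<longlongrightarrow> ?\<rho> x) (nhds x)"
    using continuous_on_eq_continuous_at[OF open_UNIV] tendsto_at_iff_tendsto_nhds
    unfolding isCont_def by blast
  have ev: "\<forall>\<^sub>F y in nhds x. y \<in> ball x r"
    by (rule eventually_nhds_in_open) (use r in auto)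
  show ?thesis
  proof (rule ccontr)
    assume "\<gamma> (tangential \<nu> x) \<noteq> x \<bullet> \<nu>"
    then consider "?\<rho> x > 0" | "?\<rho> x < 0" by fastforce
    then show False
    proof cases
      case 1
      then have "\<forall>\<^sub>F y in nhds x. ?\<rho> y > 0"
        using order_tendstoD(1)[OF cont] by blast
      with ev have "\<forall>\<^sub>F y in nhds x. y \<in> \<Omega>"
        by eventually_elim (simp add: mem)
      then have "x \<in> interior \<Omega>"
        unfolding eventually_nhds by (auto intro: interiorI)
      with assms(2) show False by (simp add: frontier_def)
    next
      case 2
      then have "\<forall>\<^sub>F y in nhds x. ?\<rho> y < 0"
        using order_tendstoD(2)[OF cont] by blast
      with ev have "\<forall>\<^sub>F y in nhds x. y \<in> - \<Omega>"
        by eventually_elim (simp add: mem)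
      then have "x \<in> interior (- \<Omega>)"
        unfolding eventually_nhds by (auto intro: interiorI)
      with assms(2) show False by (simp add: frontier_def interior_complement)
    qed
  qed
qed

lemma inward_unit_normal_ray:
  assumes n: "is_inward_unit_normal \<Omega> x n" and x: "x \<in> frontier \<Omega>"
  shows "h \<bullet> n > 0 \<Longrightarrow> \<forall>\<^sub>F t in at_right 0. x + t *\<^sub>R h \<in> \<Omega>"
    and "h \<bullet> n < 0 \<Longrightarrow> \<forall>\<^sub>F t in at_right 0. x + t *\<^sub>R h \<notin> \<Omega>"
proof -
  from n obtain r \<nu> \<gamma> c where ch: "C1_graph_chart \<Omega> x r \<nu> \<gamma>" and c: "c > 0"
    and d: "((\<lambda>y. y \<bullet> \<nu> - \<gamma> (tangential \<nu> y)) has_derivative (\<lambda>h. h \<bullet> (c *\<^sub>R n))) (at x)"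
    unfolding is_inward_unit_normal_def by blast
  define \<rho> where "\<rho> = (\<lambda>y. y \<bullet> \<nu> - \<gamma> (tangential \<nu> y))"
  have \<rho>x: "\<rho> x = 0"
    using C1_graph_chart_frontier[OF ch x] by (simp add: \<rho>_def)
  have eq: "\<Omega> \<inter> ball x r = {y \<in> ball x r. \<rho> y > 0}" and r: "r > 0"
    using ch unfolding C1_graph_chart_def \<rho>_def by auto
  have mem: "y \<in> \<Omega> \<longleftrightarrow> \<rho> y > 0" if "y \<in> ball x r" for y
    using eq that by (auto simp: set_eq_iff)
  have "((\<lambda>t. \<rho> (x + t *\<^sub>R h)) has_derivative (\<lambda>t. (t *\<^sub>R h) \<bullet> (c *\<^sub>R n))) (at 0)"
    by (rule has_derivative_compose[where f = "\<lambda>t. x + t *\<^sub>R h" and g = \<rho>])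
       (use d in \<open>auto intro!: derivative_eq_intros simp: \<rho>_def\<close>)
  then have "((\<lambda>t. \<rho> (x + t *\<^sub>R h)) has_real_derivative (c * (h \<bullet> n))) (at 0)"
    unfolding has_field_derivative_def
    by (rule has_derivative_eq_rhs) (auto simp: fun_eq_iff)
  then have "((\<lambda>t. (\<rho> (x + t *\<^sub>R h) - \<rho> x) / t) \<longlongrightarrow> c * (h \<bullet> n)) (at 0)"
    by (simp add: has_field_derivative_iff)
  then have lim: "((\<lambda>t. \<rho> (x + t *\<^sub>R h) / t) \<longlongrightarrow> c * (h \<bullet> n)) (at_right 0)"
    by (simp add: \<rho>x filterlim_at_split)
  have "((\<lambda>t. x + t *\<^sub>R h) \<longlongrightarrow> x + 0 *\<^sub>R h) (at_right 0)"
    by (intro tendsto_intros)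
  then have b: "\<forall>\<^sub>F t in at_right 0. x + t *\<^sub>R h \<in> ball x r"
    using r by (intro topological_tendstoD) auto
  have pos: "\<forall>\<^sub>F t in at_right (0::real). t > 0"
    by (rule eventually_at_right_less)
  {
    assume "h \<bullet> n > 0"
    then have "\<forall>\<^sub>F t in at_right 0. \<rho> (x + t *\<^sub>R h) / t > 0"
      using c by (intro order_tendstoD(1)[OF lim]) simp
    with b pos show "\<forall>\<^sub>F t in at_right 0. x + t *\<^sub>R h \<in> \<Omega>"
      by eventually_elim (simp add: mem zero_less_divide_iff)
  }
  {
    assume "h \<bullet> n < 0"
    then have "\<forall>\<^sub>F t in at_right 0. \<rho> (x + t *\<^sub>R h) / t < 0"
      using c by (intro order_tendstoD(2)[OF lim]) (simp add: mult_pos_neg)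
    with b pos show "\<forall>\<^sub>F t in at_right 0. x + t *\<^sub>R h \<notin> \<Omega>"
      by eventually_elim (simp add: mem divide_less_0_iff)
  }
qed

lemma is_inward_unit_normal_exists:
  assumes "C1_boundary \<Omega>" "x \<in> frontier \<Omega>"
  shows "\<exists>n. is_inward_unit_normal \<Omega> x n"
proof -
  from assms obtain r \<nu> \<gamma> where ch: "C1_graph_chart \<Omega> x r \<nu> \<gamma>"
    unfolding C1_boundary_def by blast
  then obtain g where g: "C1_with_gradient UNIV \<gamma> g" and \<nu>: "norm \<nu> = 1"
    unfolding C1_graph_chart_def by blast
  define w where "w = g (tangential \<nu> x)"
  define m where "m = \<nu> - tangential \<nu> w"
  have "\<nu> \<bullet> \<nu> = 1" using \<nu> by (simp add: dot_square_norm)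
  then have "m \<bullet> \<nu> = 1"
    by (simp add: m_def tangential_def algebra_simps)
  then have m: "m \<noteq> 0" by auto
  have "(\<gamma> has_derivative (\<lambda>h. h \<bullet> w)) (at (tangential \<nu> x))"
    using g unfolding C1_with_gradient_def w_def by simp
  moreover have "(tangential \<nu> has_derivative (\<lambda>h. tangential \<nu> h)) (at x)"
    unfolding tangential_def by (auto intro!: derivative_eq_intros)
  ultimately have "((\<lambda>y. \<gamma> (tangential \<nu> y)) has_derivative (\<lambda>h. tangential \<nu> h \<bullet> w)) (at x)"
    by (rule has_derivative_compose[rotated])
  then have "((\<lambda>y. y \<bullet> \<nu> - \<gamma> (tangential \<nu> y)) has_derivative (\<lambda>h. h \<bullet> \<nu> - tangential \<nu> h \<bullet> w)) (at x)"
    by (auto intro!: derivative_eq_intros)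
  moreover have "h \<bullet> \<nu> - tangential \<nu> h \<bullet> w = h \<bullet> (norm m *\<^sub>R sgn m)" for h
    using m by (simp add: sgn_div_norm m_def tangential_def algebra_simps inner_commute)
  ultimately have "((\<lambda>y. y \<bullet> \<nu> - \<gamma> (tangential \<nu> y)) has_derivative (\<lambda>h. h \<bullet> (norm m *\<^sub>R sgn m))) (at x)"
    by simp
  moreover have "norm (sgn m) = 1" "norm m > 0"
    using m by (auto simp: norm_sgn)
  ultimately show ?thesis
    using ch unfolding is_inward_unit_normal_def by blast
qed

lemma is_inward_unit_normal_unique:
  assumes n: "is_inward_unit_normal \<Omega> x n" and m: "is_inward_unit_normal \<Omega> x m"
    and x: "x \<in> frontier \<Omega>"
  shows "n = m"
proof (rule ccontr)
  assume "n \<noteq> m"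
  have nn: "n \<bullet> n = 1" "m \<bullet> m = 1"
    using n m by (auto simp: is_inward_unit_normal_def dot_square_norm)
  have "(n - m) \<bullet> (n - m) > 0" using \<open>n \<noteq> m\<close> by simp
  then have lt: "n \<bullet> m < 1"
    using nn by (simp add: algebra_simps inner_commute)
  have "\<forall>\<^sub>F t in at_right 0. x + t *\<^sub>R (n - m) \<in> \<Omega>"
    by (rule inward_unit_normal_ray(1)[OF n x])
       (use nn lt in \<open>simp add: algebra_simps inner_commute\<close>)
  moreover have "\<forall>\<^sub>F t in at_right 0. x + t *\<^sub>R (n - m) \<notin> \<Omega>"
    by (rule inward_unit_normal_ray(2)[OF m x])
       (use nn lt in \<open>simp add: algebra_simps inner_commute\<close>)
  ultimately have "\<forall>\<^sub>F t in at_right (0::real). False"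
    by eventually_elim blast
  then show False by simp
qed

lemma inward_unit_normal:
  assumes "C1_boundary \<Omega>" "x \<in> frontier \<Omega>"
  shows "is_inward_unit_normal \<Omega> x (inward_unit_normal \<Omega> x)"
  unfolding inward_unit_normal_def
  using is_inward_unit_normal_exists[OF assms] is_inward_unit_normal_unique[OF _ _ assms(2)]
  by (metis theI)

section \<open>Hamiltonians\<close>

definition coercive :: "('a::euclidean_space \<Rightarrow> real) \<Rightarrow> bool" where
  "coercive H \<longleftrightarrow> filterlim H at_top at_infinity"

definition quasi_convex :: "('a::euclidean_space \<Rightarrow> real) \<Rightarrow> bool" where
  "quasi_convex H \<longleftrightarrow> (\<forall>l. convex {p. H p \<le> l})"

text \<open>
  \<open>arg_min\<close> selects some minimizer; one exists when \<open>H\<close> is continuous and coercive and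
  \<open>n\<close> is a unit vector.
\<close>

definition nonincreasing_part ::
  "('a::euclidean_space \<Rightarrow> real) \<Rightarrow> 'a \<Rightarrow> 'a \<Rightarrow> real" where
  "nonincreasing_part H n p =
     (let p' = tangential n p;
          pN = p \<bullet> n;
          \<pi>0 = arg_min (\<lambda>t. H (p' + t *\<^sub>R n)) (\<lambda>_. True)
      in if pN \<le> \<pi>0 then H (p' + pN *\<^sub>R n) else H (p' + \<pi>0 *\<^sub>R n))"

section \<open>Envelopes and viscosity inequalities\<close>

definition locally_bounded_on :: "'a::euclidean_space set \<Rightarrow> ('a \<Rightarrow> real) \<Rightarrow> bool" where
  "locally_bounded_on S u \<longleftrightarrow> (\<forall>x\<in>S. \<exists>r>0. bounded (u ` (S \<inter> ball x r)))"

text \<open>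
  The filter \<open>inf (nhds x) (principal S)\<close> is that of \<open>y \<rightarrow> x\<close> with
  \<open>y \<in> S\<close>, the value \<open>y = x\<close> being allowed (unlike in \<open>at x within S\<close>).
\<close>

definition usc_envelope :: "'a::euclidean_space set \<Rightarrow> ('a \<Rightarrow> real) \<Rightarrow> 'a \<Rightarrow> ereal" where
  "usc_envelope S u x = Limsup (inf (nhds x) (principal S)) (\<lambda>y. ereal (u y))"

definition lsc_envelope :: "'a::euclidean_space set \<Rightarrow> ('a \<Rightarrow> real) \<Rightarrow> 'a \<Rightarrow> ereal" where
  "lsc_envelope S u x = Liminf (inf (nhds x) (principal S)) (\<lambda>y. ereal (u y))"

definition touches_from_above ::
  "'a::euclidean_space set \<Rightarrow> ('a \<Rightarrow> real) \<Rightarrow> ('a \<Rightarrow> real) \<Rightarrow> 'a \<Rightarrow> bool" where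
  "touches_from_above S \<phi> u x0 \<longleftrightarrow>
     usc_envelope S u x0 = ereal (\<phi> x0) \<and>
     (\<forall>\<^sub>F y in inf (nhds x0) (principal S). usc_envelope S u y \<le> ereal (\<phi> y))"

definition touches_from_below ::
  "'a::euclidean_space set \<Rightarrow> ('a \<Rightarrow> real) \<Rightarrow> ('a \<Rightarrow> real) \<Rightarrow> 'a \<Rightarrow> bool" where
  "touches_from_below S \<phi> u x0 \<longleftrightarrow>
     lsc_envelope S u x0 = ereal (\<phi> x0) \<and>
     (\<forall>\<^sub>F y in inf (nhds x0) (principal S). lsc_envelope S u y \<ge> ereal (\<phi> y))"

text \<open>
  In the next two definitions, the inequality \<open>u + G x (\<nabla>u) \<le> 0\<close> (resp. \<open>\<ge> 0\<close>) is
  required at the points \<open>x\<close> of \<open>S\<close>, a subset of \<open>closure \<Omega>\<close>.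
\<close>

definition viscosity_le ::
  "'a::euclidean_space set \<Rightarrow> ('a \<Rightarrow> 'a \<Rightarrow> real) \<Rightarrow> ('a \<Rightarrow> real) \<Rightarrow> 'a set \<Rightarrow> bool" where
  "viscosity_le \<Omega> G u S \<longleftrightarrow>
     (\<forall>\<phi> D\<phi>. \<forall>x0\<in>S. C1_with_gradient (closure \<Omega>) \<phi> D\<phi> \<longrightarrow>
        touches_from_above (closure \<Omega>) \<phi> u x0 \<longrightarrow> \<phi> x0 + G x0 (D\<phi> x0) \<le> 0)"

definition viscosity_ge ::
  "'a::euclidean_space set \<Rightarrow> ('a \<Rightarrow> 'a \<Rightarrow> real) \<Rightarrow> ('a \<Rightarrow> real) \<Rightarrow> 'a set \<Rightarrow> bool" where
  "viscosity_ge \<Omega> G u S \<longleftrightarrow>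
     (\<forall>\<phi> D\<phi>. \<forall>x0\<in>S. C1_with_gradient (closure \<Omega>) \<phi> D\<phi> \<longrightarrow>
        touches_from_below (closure \<Omega>) \<phi> u x0 \<longrightarrow> \<phi> x0 + G x0 (D\<phi> x0) \<ge> 0)"

definition viscosity_eq ::
  "'a::euclidean_space set \<Rightarrow> ('a \<Rightarrow> 'a \<Rightarrow> real) \<Rightarrow> ('a \<Rightarrow> real) \<Rightarrow> 'a set \<Rightarrow> bool" where
  "viscosity_eq \<Omega> G u S \<longleftrightarrow> viscosity_le \<Omega> G u S \<and> viscosity_ge \<Omega> G u S"

definition weakly_continuous_at_boundary ::
  "'a::euclidean_space set \<Rightarrow> ('a \<Rightarrow> real) \<Rightarrow> bool" where
  "weakly_continuous_at_boundary \<Omega> u \<longleftrightarrow>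
     (\<forall>x\<in>frontier \<Omega>.
        usc_envelope (closure \<Omega>) u x = Limsup (at x within \<Omega>) (usc_envelope (closure \<Omega>) u))"

definition state_constraint_solution ::
  "'a::euclidean_space set \<Rightarrow> ('a \<Rightarrow> real) \<Rightarrow> ('a \<Rightarrow> real) \<Rightarrow> bool" where
  "state_constraint_solution \<Omega> H u \<longleftrightarrow>
     viscosity_ge \<Omega> (\<lambda>x. H) u (closure \<Omega>) \<and> viscosity_le \<Omega> (\<lambda>x. H) u \<Omega>"

definition flux_limited_solution ::
  "'a::euclidean_space set \<Rightarrow> ('a \<Rightarrow> real) \<Rightarrow> ('a \<Rightarrow> real) \<Rightarrow> bool" where
  "flux_limited_solution \<Omega> H u \<longleftrightarrow>
     weakly_continuous_at_boundary \<Omega> u \<and>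
     viscosity_eq \<Omega> (\<lambda>x. H) u \<Omega> \<and>
     viscosity_eq \<Omega> (\<lambda>x. nonincreasing_part H (inward_unit_normal \<Omega> x)) u (frontier \<Omega>)"

end

theory Submission
  imports Defs
begin

text \<open>
  By quasi-convexity \<open>H\<^sup>-(p)\<close> is the minimum of \<open>H (p + s n)\<close> over \<open>s \<le> 0\<close>, so
  \<open>H\<^sup>- \<le> H\<close> and flux-limited solutions are state constraint solutions. Conversely, let
  \<open>\<rho>\<close> be a local C1 defining function, positive exactly in \<open>\<Omega>\<close>. Adding a nonpositive
  multiple of \<open>\<rho>\<close> to a function touching \<open>u\<close> from below at a boundary point keeps it
  below, and this moves its gradient by any \<open>s n\<close> with \<open>s \<le> 0\<close>. If \<open>\<phi>\<close> touches
  \<open>u\<close> from above at the boundary point \<open>x\<close>, add the penalization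
  \<open>\<bar>y - x\<bar>\<^sup>2 + 2 \<delta> exp (- C \<rho> y)\<close>: by weak continuity, for \<open>C\<close> large the
  maximum point of the difference lies in \<open>\<Omega>\<close> and is close to \<open>x\<close>, and the penalization
  contributes a nonpositive multiple of the gradient of \<open>\<rho>\<close>. Coercivity bounds that multiple,
  and the limit \<open>\<delta> \<rightarrow> 0\<close> gives \<open>u + H (p + s n) \<le> 0\<close> for some \<open>s \<le> 0\<close>.
\<close>

section \<open>The nonincreasing part\<close>

text \<open>Ensures that the \<open>arg_min\<close> in \<open>nonincreasing_part\<close> is a true
  minimizer. Far out on the line, coercivity gives values at least \<open>H q\<close>, the value at
  parameter 0, so the minimum over a compact interval around 0 is global.\<close>

lemma coercive_line_has_minimum:
  fixes H :: "'a::euclidean_space \<Rightarrow> real"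
  assumes H: "continuous_on UNIV H" "coercive H" and n: "norm n = 1"
  shows "\<exists>t0. \<forall>t. H (q + t0 *\<^sub>R n) \<le> H (q + t *\<^sub>R n)"
proof -
  have "\<forall>\<^sub>F z in at_infinity. H q \<le> H z"
    using H(2) unfolding coercive_def filterlim_at_top by blast
  then obtain b where b: "\<And>z. b \<le> norm z \<Longrightarrow> H q \<le> H z"
    unfolding eventually_at_infinity by blast
  \<comment> \<open>As \<open>norm n = 1\<close>, the triangle inequality gives
    \<open>b \<le> norm (q + t *\<^sub>R n)\<close> for every \<open>t\<close> outside
    \<open>{-B..B}\<close>.\<close>
  define B where "B = \<bar>b\<bar> + norm q"
  have "continuous_on {-B..B} (\<lambda>t. H (q + t *\<^sub>R n))"
    by (intro continuous_on_compose2[OF H(1)] continuous_intros) auto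
  then obtain t0 where t0: "t0 \<in> {-B..B}"
      "\<And>t. t \<in> {-B..B} \<Longrightarrow> H (q + t0 *\<^sub>R n) \<le> H (q + t *\<^sub>R n)"
    using continuous_attains_inf[of "{-B..B}" "\<lambda>t. H (q + t *\<^sub>R n)"]
    by (force simp: B_def)
  have "H (q + t0 *\<^sub>R n) \<le> H (q + t *\<^sub>R n)" for t
  proof (cases "t \<in> {-B..B}")
    case False
    have "norm (t *\<^sub>R n) \<le> norm (q + t *\<^sub>R n) + norm q"
      using norm_triangle_ineq4[of "q + t *\<^sub>R n" q] by simp
    with False n have "b \<le> norm (q + t *\<^sub>R n)"
      by (auto simp: B_def)
    then have "H q \<le> H (q + t *\<^sub>R n)" by (rule b)
    moreover have "H (q + t0 *\<^sub>R n) \<le> H q"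
      using t0(2)[of 0] add_nonneg_nonneg[OF abs_ge_zero norm_ge_zero, of b q]
      by (simp add: B_def)
    ultimately show ?thesis by simp
  qed (use t0 in blast)
  then show ?thesis by blast
qed

text \<open>The shift moves \<open>p\<close> down to the chosen minimizer, or is 0 when
  \<open>p\<close> already lies at or below it.\<close>

lemma nonincreasing_part_eq_shift:
  "\<exists>s\<le>0. nonincreasing_part H n p = H (p + s *\<^sub>R n)"
proof -
  define \<pi> where "\<pi> = arg_min (\<lambda>t. H (tangential n p + t *\<^sub>R n)) (\<lambda>_. True)"
  have "nonincreasing_part H n p = H (p + min 0 (\<pi> - p \<bullet> n) *\<^sub>R n)"
    unfolding nonincreasing_part_def Let_def \<pi>_def[symmetric]
    by (simp add: tangential_def min_def algebra_simps)
  then show ?thesis by (meson min.cobounded1)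
qed

text \<open>On the line through \<open>p\<close> sublevel sets are intervals. If \<open>p\<close>
  lies at or below the minimizer, the interval at the level of the shifted point contains that point
  and the minimizer, hence \<open>p\<close> between them. Otherwise the value is the minimum over
  the line.\<close>

lemma nonincreasing_part_le_shift:
  fixes H :: "'a::euclidean_space \<Rightarrow> real"
  assumes H: "continuous_on UNIV H" "coercive H" "quasi_convex H"
    and n: "norm n = 1" and s: "s \<le> 0"
  shows "nonincreasing_part H n p \<le> H (p + s *\<^sub>R n)"
proof -
  define f where "f = (\<lambda>t. H (tangential n p + t *\<^sub>R n))"
  define \<pi> where "\<pi> = arg_min f (\<lambda>_. True)"
  have "\<exists>t. is_arg_min f (\<lambda>_. True) t"
    using coercive_line_has_minimum[OF H(1,2) n, of "tangential n p"]
    by (auto simp: is_arg_min_def f_def not_less)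
  then have "is_arg_min f (\<lambda>_. True) \<pi>"
    unfolding \<pi>_def arg_min_def by (rule someI_ex)
  then have \<pi>: "f \<pi> \<le> f t" for t
    by (auto simp: is_arg_min_def not_less)
  have fs: "f (p \<bullet> n + s) = H (p + s *\<^sub>R n)"
    by (simp add: f_def tangential_def algebra_simps)
  have eq: "nonincreasing_part H n p = (if p \<bullet> n \<le> \<pi> then f (p \<bullet> n) else f \<pi>)"
    unfolding nonincreasing_part_def Let_def \<pi>_def f_def by simp
  show ?thesis
  proof (cases "p \<bullet> n \<le> \<pi>")
    case True
    \<comment> \<open>Translating the sublevel set first turns the affine parametrization of the
      line into a linear map, whose preimages preserve convexity.\<close>
    have "convex ((\<lambda>t. tangential n p + t *\<^sub>R n) -` {q. H q \<le> f (p \<bullet> n + s)})"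
    proof -
      have "convex {q. H q \<le> f (p \<bullet> n + s)}"
        using H(3) by (auto simp: quasi_convex_def)
      then have c: "convex ((\<lambda>x. - tangential n p + x) ` {q. H q \<le> f (p \<bullet> n + s)})"
        by (rule convex_translation)
      have "(\<lambda>t. tangential n p + t *\<^sub>R n) -` {q. H q \<le> f (p \<bullet> n + s)}
          = (\<lambda>t. t *\<^sub>R n) -` ((\<lambda>x. - tangential n p + x) ` {q. H q \<le> f (p \<bullet> n + s)})"
        by (force simp: image_iff)
      moreover have "linear (\<lambda>t::real. t *\<^sub>R n)"
        by (simp add: linear_iff algebra_simps)
      ultimately show ?thesis using convex_linear_vimage[OF _ c] by metis
    qed
    then have "is_interval {t. f t \<le> f (p \<bullet> n + s)}"
      by (simp add: is_interval_convex_1 f_def vimage_def)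
    moreover have "p \<bullet> n + s \<le> p \<bullet> n" using s by simp
    ultimately have "f (p \<bullet> n) \<le> f (p \<bullet> n + s)"
      using \<pi>[of "p \<bullet> n + s"] True unfolding is_interval_1 by blast
    then show ?thesis using True eq fs by simp
  next
    case False
    then show ?thesis using eq fs \<pi> by metis
  qed
qed

section \<open>Upper semicontinuity of the envelope\<close>

text \<open>A bound for \<open>u\<close> near \<open>x\<close> is also a bound near each point close
  to \<open>x\<close>, so it passes to the envelope there.\<close>

lemma usc_envelope_upper_semicontinuous:
  assumes "usc_envelope S u x < c"
  shows "\<forall>\<^sub>F y in nhds x. usc_envelope S u y < c"
proof -
  \<comment> \<open>The intermediate level keeps the conclusion strict, since a
    \<open>Limsup\<close> only inherits \<open>\<le>\<close>.\<close>
  obtain c' where c': "usc_envelope S u x < c'" "c' < c"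
    using dense assms by blast
  then have "\<forall>\<^sub>F y in inf (nhds x) (principal S). ereal (u y) < c'"
    unfolding usc_envelope_def by (intro Limsup_lessD) auto
  then have "\<forall>\<^sub>F y in nhds x. y \<in> S \<longrightarrow> ereal (u y) < c'"
    by (simp add: eventually_inf_principal)
  then have "\<forall>\<^sub>F z in nhds x. \<forall>\<^sub>F y in nhds z. y \<in> S \<longrightarrow> ereal (u y) < c'"
    by (simp add: eventually_eventually)
  then show ?thesis
  proof eventually_elim
    case (elim z)
    then have "\<forall>\<^sub>F y in inf (nhds z) (principal S). ereal (u y) \<le> c'"
      by (auto simp: eventually_inf_principal elim: eventually_mono)
    then have "usc_envelope S u z \<le> c'"
      unfolding usc_envelope_def by (rule Limsup_bounded)
    with c' show ?case by simp
  qed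
qed

text \<open>Without a maximum, the open sets \<open>U z\<close> cover \<open>K\<close>. In a finite
  subcover, the index with the largest value of \<open>f\<close> would lie in some
  \<open>U w\<close>, so that \<open>f w\<close> would be larger still.\<close>

lemma upper_semicontinuous_attains_max:
  fixes f :: "'a::topological_space \<Rightarrow> 'b::linorder"
  assumes "compact K" "K \<noteq> {}"
    and usc: "\<And>x c. x \<in> K \<Longrightarrow> f x < c \<Longrightarrow> \<forall>\<^sub>F y in nhds x. y \<in> K \<longrightarrow> f y < c"
  shows "\<exists>x\<in>K. \<forall>y\<in>K. f y \<le> f x"
proof (rule ccontr)
  assume "\<not> ?thesis"
  then have ex: "\<forall>x\<in>K. \<exists>z\<in>K. f x < f z" by (auto simp: not_le)
  define U where "U z = interior {y. y \<in> K \<longrightarrow> f y < f z}" for z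
  have "K \<subseteq> (\<Union>z\<in>K. U z)"
  proof
    fix x assume "x \<in> K"
    then obtain z where "z \<in> K" "f x < f z" using ex by blast
    moreover from this have "x \<in> U z"
      using usc[OF \<open>x \<in> K\<close>, of "f z"] unfolding U_def eventually_nhds
      by (auto intro: interiorI)
    ultimately show "x \<in> (\<Union>z\<in>K. U z)" by blast
  qed
  then obtain D where D: "D \<subseteq> K" "finite D" "K \<subseteq> (\<Union>z\<in>D. U z)"
    using compactE_image[OF assms(1), of K U] by (metis U_def open_interior)
  with assms(2) have "D \<noteq> {}" by auto
  have "Max (f ` D) \<in> f ` D" using D \<open>D \<noteq> {}\<close> by simp
  then obtain z where z: "z \<in> D" "f z = Max (f ` D)" by auto
  then obtain w where w: "w \<in> D" "z \<in> U w" using D by blast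
  then have "f z < f w" using interior_subset z D unfolding U_def by blast
  moreover have "f w \<le> f z" using z w D by simp
  ultimately show False by simp
qed

section \<open>Defining functions of the domain\<close>

text \<open>Trades the chart for one scalar function, so that later arguments see the domain near
  \<open>x\<close> only through the sign of \<open>\<rho>\<close> and the direction of its
  gradient.\<close>

lemma boundary_defining_function:
  fixes \<Omega> :: "'a::euclidean_space set"
  assumes n: "is_inward_unit_normal \<Omega> x n" and x: "x \<in> frontier \<Omega>"
  obtains r c \<rho> G where "r > 0" "c > 0" "C1_with_gradient UNIV \<rho> G"
    "\<rho> x = 0" "G x = c *\<^sub>R n"
    "\<And>y. y \<in> ball x r \<Longrightarrow> y \<in> \<Omega> \<longleftrightarrow> 0 < \<rho> y"
    "\<And>y. y \<in> ball x r \<Longrightarrow> y \<in> closure \<Omega> \<Longrightarrow> 0 \<le> \<rho> y"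
proof -
  from n obtain r \<nu> \<gamma> c where ch: "C1_graph_chart \<Omega> x r \<nu> \<gamma>" and c: "c > 0"
    and d: "((\<lambda>y. y \<bullet> \<nu> - \<gamma> (tangential \<nu> y)) has_derivative (\<lambda>h. h \<bullet> (c *\<^sub>R n))) (at x)"
    unfolding is_inward_unit_normal_def by blast
  define \<rho> where "\<rho> = (\<lambda>y. y \<bullet> \<nu> - \<gamma> (tangential \<nu> y))"
  obtain g where g: "C1_with_gradient UNIV \<gamma> g"
    using ch unfolding C1_graph_chart_def by blast
  have r: "r > 0" and eq: "\<Omega> \<inter> ball x r = {y \<in> ball x r. 0 < \<rho> y}"
    using ch unfolding C1_graph_chart_def \<rho>_def by auto
  have mem: "y \<in> \<Omega> \<longleftrightarrow> 0 < \<rho> y" if "y \<in> ball x r" for y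
    using eq that by (auto simp: set_eq_iff)
  \<comment> \<open>The chain rule, with the self-adjoint map \<open>tangential \<nu>\<close> moved
    onto the gradient of \<open>\<gamma>\<close>.\<close>
  define G where "G = (\<lambda>y. \<nu> - tangential \<nu> (g (tangential \<nu> y)))"
  have G: "(\<rho> has_derivative (\<lambda>h. h \<bullet> G y)) (at y)" for y
  proof -
    have "(\<gamma> has_derivative (\<lambda>h. h \<bullet> g (tangential \<nu> y))) (at (tangential \<nu> y))"
      using g unfolding C1_with_gradient_def by simp
    moreover have "(tangential \<nu> has_derivative tangential \<nu>) (at y)"
      unfolding tangential_def by (auto intro!: derivative_eq_intros)
    ultimately have "((\<lambda>y. \<gamma> (tangential \<nu> y)) has_derivative
        (\<lambda>h. tangential \<nu> h \<bullet> g (tangential \<nu> y))) (at y)"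
      by (rule has_derivative_compose[rotated])
    then have "(\<rho> has_derivative (\<lambda>h. h \<bullet> \<nu> - tangential \<nu> h \<bullet> g (tangential \<nu> y))) (at y)"
      unfolding \<rho>_def by (auto intro!: derivative_eq_intros)
    then show ?thesis
      by (rule has_derivative_eq_rhs)
         (simp add: fun_eq_iff G_def tangential_def algebra_simps inner_commute)
  qed
  have "continuous_on UNIV G"
    unfolding G_def tangential_def
    using g unfolding C1_with_gradient_def
    by (auto intro!: continuous_intros continuous_on_compose2[of UNIV g])
  with G have C1: "C1_with_gradient UNIV \<rho> G"
    by (simp add: C1_with_gradient_def)
  have "(\<lambda>h. h \<bullet> G x) = (\<lambda>h. h \<bullet> (c *\<^sub>R n))"
    using has_derivative_unique[OF G[of x]] d unfolding \<rho>_def by blast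
  then have Gx: "G x = c *\<^sub>R n"
    by (metis inner_commute vector_eq_ldot)
  have "0 \<le> \<rho> y" if y: "y \<in> ball x r" "y \<in> closure \<Omega>" for y
  proof (rule ccontr)
    assume "\<not> 0 \<le> \<rho> y"
    moreover have "(\<rho> \<longlongrightarrow> \<rho> y) (nhds y)"
      using has_derivative_continuous[OF G] by (simp add: isCont_def tendsto_at_iff_tendsto_nhds)
    ultimately have "\<forall>\<^sub>F z in nhds y. \<rho> z < 0"
      by (intro order_tendstoD) auto
    moreover have "\<forall>\<^sub>F z in nhds y. z \<in> ball x r"
      using y by (intro eventually_nhds_in_open) auto
    ultimately have "\<forall>\<^sub>F z in nhds y. z \<in> - \<Omega>"
      by eventually_elim (simp add: mem)
    then have "y \<in> interior (- \<Omega>)"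
      unfolding eventually_nhds by (auto intro: interiorI)
    with y(2) show False by (simp add: interior_complement)
  qed
  moreover have "\<rho> x = 0"
    using C1_graph_chart_frontier[OF ch x] by (simp add: \<rho>_def)
  ultimately show thesis using that r c C1 Gx mem by blast
qed

lemma C1_with_gradient_subset:
  "C1_with_gradient S f g \<Longrightarrow> T \<subseteq> S \<Longrightarrow> C1_with_gradient T f g"
  unfolding C1_with_gradient_def
  by (meson continuous_on_subset has_derivative_subset subset_eq)

lemma C1_with_gradient_continuous_on:
  "C1_with_gradient S f g \<Longrightarrow> continuous_on S f"
  unfolding C1_with_gradient_def
  by (metis continuous_on_eq_continuous_within has_derivative_continuous)

section \<open>Boundary conditions of state constraint solutions\<close>

lemma supersolution_nonincreasing_part:
  fixes \<Omega> :: "'a::euclidean_space set"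
  assumes bd: "C1_boundary \<Omega>" and ge: "viscosity_ge \<Omega> (\<lambda>x. H) u (closure \<Omega>)"
  shows "viscosity_ge \<Omega> (\<lambda>x. nonincreasing_part H (inward_unit_normal \<Omega> x)) u (frontier \<Omega>)"
  unfolding viscosity_ge_def
proof (intro allI ballI impI)
  fix \<phi> D\<phi> x
  assume x: "x \<in> frontier \<Omega>" and C1: "C1_with_gradient (closure \<Omega>) \<phi> D\<phi>"
    and t: "touches_from_below (closure \<Omega>) \<phi> u x"
  define n where "n = inward_unit_normal \<Omega> x"
  have n: "is_inward_unit_normal \<Omega> x n"
    unfolding n_def using inward_unit_normal[OF bd x] .
  obtain r c \<rho> G where r: "r > 0" "c > 0" and \<rho>: "C1_with_gradient UNIV \<rho> G" "\<rho> x = 0" "G x = c *\<^sub>R n"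
    "\<And>y. y \<in> ball x r \<Longrightarrow> y \<in> closure \<Omega> \<Longrightarrow> 0 \<le> \<rho> y"
    using boundary_defining_function[OF n x] by metis
  have xc: "x \<in> closure \<Omega>" using x by (simp add: frontier_def)
  obtain s where s: "s \<le> 0" "nonincreasing_part H n (D\<phi> x) = H (D\<phi> x + s *\<^sub>R n)"
    using nonincreasing_part_eq_shift by blast
  \<comment> \<open>As \<open>G x = c *\<^sub>R n\<close>, the factor \<open>s / c\<close> moves the
    gradient at \<open>x\<close> by exactly \<open>s *\<^sub>R n\<close>, while
    \<open>\<rho> x = 0\<close> keeps the value there.\<close>
  define \<psi> where "\<psi> = (\<lambda>y. \<phi> y + s / c * \<rho> y)"
  define D\<psi> where "D\<psi> = (\<lambda>y. D\<phi> y + (s / c) *\<^sub>R G y)"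
  have "C1_with_gradient (closure \<Omega>) \<psi> D\<psi>"
    using C1 C1_with_gradient_subset[OF \<rho>(1), of "closure \<Omega>"] r(2)
    unfolding C1_with_gradient_def \<psi>_def D\<psi>_def
    by (auto intro!: continuous_intros derivative_eq_intros simp: algebra_simps)
  moreover have "touches_from_below (closure \<Omega>) \<psi> u x"
  proof -
    have "\<forall>\<^sub>F y in nhds x. y \<in> ball x r"
      using r by (intro eventually_nhds_in_open) auto
    moreover have "\<forall>\<^sub>F y in nhds x. y \<in> closure \<Omega> \<longrightarrow> ereal (\<phi> y) \<le> lsc_envelope (closure \<Omega>) u y"
      using t by (simp add: touches_from_below_def eventually_inf_principal)
    ultimately have "\<forall>\<^sub>F y in nhds x. y \<in> closure \<Omega> \<longrightarrow> ereal (\<psi> y) \<le> lsc_envelope (closure \<Omega>) u y"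
    proof eventually_elim
      case (elim y)
      have "\<psi> y \<le> \<phi> y" if "y \<in> closure \<Omega>"
        using \<rho>(4)[OF elim(1) that] s r by (simp add: \<psi>_def mult_nonpos_nonneg divide_nonpos_pos)
      then show ?case using elim(2) by (meson ereal_less_eq(3) order_trans)
    qed
    then show ?thesis
      using t \<rho>(2) by (simp add: touches_from_below_def eventually_inf_principal \<psi>_def)
  qed
  ultimately have "\<psi> x + H (D\<psi> x) \<ge> 0"
    using ge xc unfolding viscosity_ge_def by blast
  then show "\<phi> x + nonincreasing_part H (inward_unit_normal \<Omega> x) (D\<phi> x) \<ge> 0"
    using r s by (simp add: \<psi>_def D\<psi>_def \<rho>(2,3) n_def)
qed

text \<open>The point \<open>y\<close> is a maximum point of \<open>u\<^sup>* - \<phi>\<close> penalized away from the boundary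
  and from \<open>x\<close>; \<open>s G y\<close> is the gradient of the boundary penalization.\<close>

lemma penalized_interior_point:
  fixes \<Omega> :: "'a::euclidean_space set"
  assumes "open \<Omega>" and x: "x \<in> frontier \<Omega>"
    and weak: "usc_envelope (closure \<Omega>) u x
        = Limsup (at x within \<Omega>) (usc_envelope (closure \<Omega>) u)"
    and le: "viscosity_le \<Omega> (\<lambda>x. H) u \<Omega>"
    and C1: "C1_with_gradient (closure \<Omega>) \<phi> D\<phi>"
    and t: "touches_from_above (closure \<Omega>) \<phi> u x"
    and r: "r > 0" and \<rho>: "C1_with_gradient UNIV \<rho> G"
      "\<And>y. y \<in> ball x r \<Longrightarrow> y \<in> \<Omega> \<longleftrightarrow> 0 < \<rho> y"
    and e: "e > 0"
  shows "\<exists>y s. y \<in> \<Omega> \<and> dist y x < e \<and> s \<le> 0 \<and>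
    H (D\<phi> y + 2 *\<^sub>R (y - x) + s *\<^sub>R G y) \<le> - \<phi> y + e"
proof -
  define U where "U = usc_envelope (closure \<Omega>) u"
  have xc: "x \<in> closure \<Omega>" using x by (simp add: frontier_def)
  have "\<forall>\<^sub>F y in nhds x. y \<in> closure \<Omega> \<longrightarrow> U y \<le> ereal (\<phi> y)"
    using t by (simp add: touches_from_above_def eventually_inf_principal U_def)
  then obtain r0 where r0: "r0 > 0"
    "\<And>y. dist y x < r0 \<Longrightarrow> y \<in> closure \<Omega> \<Longrightarrow> U y \<le> ereal (\<phi> y)"
    unfolding eventually_nhds_metric by blast
  have Ux: "U x = ereal (\<phi> x)"
    using t by (simp add: touches_from_above_def U_def)
  \<comment> \<open>The closed ball of radius \<open>R\<close> stays where \<open>\<rho>\<close>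
    describes \<open>\<Omega>\<close>, where \<open>\<phi>\<close> dominates the envelope, and
    within distance \<open>e\<close> of \<open>x\<close>.\<close>
  define R where "R = min (min r r0) e / 2"
  have R: "R > 0" "R < r" "R < r0" "R < e"
    using r r0(1) e by (auto simp: R_def min_def)
  define K where "K = closure \<Omega> \<inter> cball x R"
  \<comment> \<open>The bound by \<open>R^2\<close> will keep the maximum point off the sphere of
    radius \<open>R\<close>; the bound by \<open>e\<close> absorbs the final error.\<close>
  define \<delta> where "\<delta> = min (R^2) e / 4"
  have \<delta>: "\<delta> > 0" "2 * \<delta> < R^2" "2 * \<delta> < e"
    using R e by (auto simp: \<delta>_def min_def)
  define \<psi> where "\<psi> = (\<lambda>y. \<phi> y + (y - x) \<bullet> (y - x))"
  have cont: "continuous_on (closure \<Omega>) \<psi>"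
    unfolding \<psi>_def using C1_with_gradient_continuous_on[OF C1] by (intro continuous_intros)
  \<comment> \<open>Weak continuity enters here: interior points arbitrarily close to
    \<open>x\<close> have envelope above \<open>\<phi> x - \<delta>/2\<close>, while
    \<open>\<psi>\<close> is below \<open>\<phi> x + \<delta>/2\<close> near
    \<open>x\<close>.\<close>
  obtain z where z: "z \<in> \<Omega>" "z \<in> K" "U z > ereal (\<psi> z - \<delta>)"
  proof -
    have "\<not> (\<forall>\<^sub>F y in at x within \<Omega>. U y \<le> ereal (\<phi> x - \<delta>/2))"
    proof
      assume "\<forall>\<^sub>F y in at x within \<Omega>. U y \<le> ereal (\<phi> x - \<delta>/2)"
      then have "Limsup (at x within \<Omega>) U \<le> ereal (\<phi> x - \<delta>/2)"
        by (rule Limsup_bounded)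
      then have "U x \<le> ereal (\<phi> x - \<delta>/2)" using weak by (simp add: U_def)
      with Ux \<delta> show False by simp
    qed
    then have fr: "\<exists>\<^sub>F y in at x within \<Omega>. U y > ereal (\<phi> x - \<delta>/2)"
      by (simp add: frequently_def not_less)
    have "(\<psi> \<longlongrightarrow> \<psi> x) (at x within closure \<Omega>)"
      using cont xc by (simp add: continuous_on_def)
    then have "(\<psi> \<longlongrightarrow> \<psi> x) (at x within \<Omega>)"
      by (rule tendsto_within_subset[OF _ closure_subset])
    then have "\<forall>\<^sub>F y in at x within \<Omega>. \<psi> y < \<phi> x + \<delta>/2"
      by (rule order_tendstoD) (simp add: \<psi>_def \<delta>)
    moreover have "\<forall>\<^sub>F y in at x within \<Omega>. y \<in> \<Omega> \<and> dist y x < R"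
      using R by (auto simp: eventually_at)
    ultimately have "\<forall>\<^sub>F y in at x within \<Omega>. y \<in> \<Omega> \<and> dist y x < R \<and> \<psi> y < \<phi> x + \<delta>/2"
      by eventually_elim simp
    from frequently_eventually_conj[OF fr this]
    obtain z where z: "U z > ereal (\<phi> x - \<delta>/2)" "z \<in> \<Omega>" "dist z x < R" "\<psi> z < \<phi> x + \<delta>/2"
      using frequently_ex by fast
    have "ereal (\<psi> z - \<delta>) < U z"
      by (rule less_trans[OF _ z(1)]) (use z(4) in simp)
    moreover have "z \<in> K"
      using z closure_subset by (auto simp: K_def dist_commute)
    ultimately show thesis using that z(2) by blast
  qed
  have zb: "y \<in> ball x r" if "y \<in> K" for y
    using that R by (auto simp: K_def)
  have \<rho>z: "\<rho> z > 0" using \<rho>(2)[OF zb[OF z(2)]] z(1) by simp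
  \<comment> \<open>The penalty \<open>2 * \<delta> * exp (- C * \<rho> y)\<close> equals
    \<open>2 * \<delta>\<close> where \<open>\<rho>\<close> vanishes; this \<open>C\<close> makes it
    exactly \<open>\<delta>\<close> at \<open>z\<close>.\<close>
  define C where "C = ln 2 / \<rho> z"
  have C: "C > 0" "exp (- C * \<rho> z) = 1/2"
    using \<rho>z by (simp_all add: C_def exp_minus)
  define \<theta> where "\<theta> = (\<lambda>y. \<psi> y + 2 * \<delta> * exp (- C * \<rho> y))"
  define f where "f = (\<lambda>y. U y - ereal (\<theta> y))"
  have \<theta>c: "continuous_on (closure \<Omega>) \<theta>"
    unfolding \<theta>_def
    using continuous_on_subset[OF C1_with_gradient_continuous_on[OF \<rho>(1)] subset_UNIV] cont
    by (intro continuous_intros) auto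
  have "\<exists>y\<in>K. \<forall>w\<in>K. f w \<le> f y"
  proof (rule upper_semicontinuous_attains_max)
    show "compact K"
      unfolding K_def by (rule closed_Int_compact) auto
    show "K \<noteq> {}" using z by blast
    fix y c assume y: "y \<in> K" and less: "f y < c"
    then have "U y < c + ereal (\<theta> y)"
      by (simp add: f_def ereal_minus_less)
    \<comment> \<open>A real level \<open>d\<close> replaces the possibly infinite envelope, so that
      continuity of \<open>\<theta>\<close> can be used on real values.\<close>
    then obtain d where d: "U y < ereal d" "ereal d < c + ereal (\<theta> y)"
      using ereal_dense2 by blast
    have d_less: "ereal (d - \<theta> y) < c"
      using d(2) by (cases c) auto
    have "(\<theta> \<longlongrightarrow> \<theta> y) (at y within closure \<Omega>)"
      using \<theta>c y by (simp add: continuous_on_def K_def)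
    then have "((\<lambda>w. ereal (d - \<theta> w)) \<longlongrightarrow> ereal (d - \<theta> y)) (at y within closure \<Omega>)"
      by (intro tendsto_intros)
    then have "\<forall>\<^sub>F w in at y within closure \<Omega>. ereal (d - \<theta> w) < c"
      using d_less by (rule order_tendstoD)
    then have "\<forall>\<^sub>F w in nhds y. w \<in> K \<longrightarrow> ereal (d - \<theta> w) < c"
      unfolding eventually_at_filter
      by eventually_elim (use d_less in \<open>auto simp: K_def\<close>)
    moreover have "\<forall>\<^sub>F w in nhds y. U w < ereal d"
      using usc_envelope_upper_semicontinuous d(1) unfolding U_def by blast
    ultimately show "\<forall>\<^sub>F w in nhds y. w \<in> K \<longrightarrow> f w < c"
    proof eventually_elim
      case (elim w)
      have "f w \<le> ereal (d - \<theta> w)"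
        using ereal_minus_mono[of "U w" "ereal d" "ereal (\<theta> w)" "ereal (\<theta> w)"] elim(2)
        by (simp add: f_def)
      with elim(1) show ?case by force
    qed
  qed
  then obtain y where y: "y \<in> K" and ymax: "\<And>w. w \<in> K \<Longrightarrow> f w \<le> f y" by blast
  have "\<theta> z = \<psi> z + \<delta>"
    unfolding \<theta>_def C(2) by simp
  then have "ereal (- 2 * \<delta>) < f z"
    using z(3) by (cases "U z") (auto simp: f_def)
  also have "\<dots> \<le> f y" using ymax z(2) .
  finally have fy: "ereal (- 2 * \<delta>) < f y" .
  have "U y \<le> ereal (\<phi> y)"
    using r0(2)[of y] y R by (auto simp: K_def dist_commute)
  then obtain v where v: "U y = ereal v" "v \<le> \<phi> y"
    using fy by (cases "U y") (auto simp: f_def)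
  have v_gt: "v - \<theta> y > - 2 * \<delta>" using fy v by (simp add: f_def)
  \<comment> \<open>Both summands are nonnegative: the first being below
    \<open>2 * \<delta> < R^2\<close> keeps \<open>y\<close> near \<open>x\<close>, the second being
    below \<open>2 * \<delta>\<close> forces \<open>\<rho> y > 0\<close>.\<close>
  then have small: "(y - x) \<bullet> (y - x) + 2 * \<delta> * exp (- C * \<rho> y) < 2 * \<delta>"
    using v(2) by (simp add: \<theta>_def \<psi>_def)
  have "exp (- C * \<rho> y) < 1"
  proof (rule ccontr)
    assume "\<not> exp (- C * \<rho> y) < 1"
    then have "2 * \<delta> * 1 \<le> 2 * \<delta> * exp (- C * \<rho> y)"
      using \<delta>(1) by (intro mult_left_mono) auto
    then show False using small inner_ge_zero[of "y - x"] by linarith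
  qed
  then have "\<rho> y > 0" using C(1) by (simp add: zero_less_mult_iff)
  then have y\<Omega>: "y \<in> \<Omega>" using \<rho>(2)[OF zb[OF y]] by simp
  have exp_pos: "2 * \<delta> * exp (- C * \<rho> y) > 0" using \<delta>(1) by simp
  have "(dist y x)\<^sup>2 = (y - x) \<bullet> (y - x)"
    by (simp add: dist_norm power2_norm_eq_inner)
  then have "(dist y x)\<^sup>2 < R\<^sup>2"
    using small \<delta>(2) exp_pos by linarith
  \<comment> \<open>Strictness makes \<open>K\<close> a neighbourhood of \<open>y\<close> in the
    closure, so the maximum over \<open>K\<close> is a local one there.\<close>
  then have dy: "dist y x < R" by (rule power2_less_imp_less) (use R in simp)
  \<comment> \<open>The added constant makes \<open>\<Theta> y = v\<close>, the value of the
    envelope at \<open>y\<close>.\<close>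
  define \<Theta> where "\<Theta> = (\<lambda>w. \<theta> w + (v - \<theta> y))"
  define D\<Theta> where "D\<Theta> = (\<lambda>w. D\<phi> w + 2 *\<^sub>R (w - x) + (- 2 * \<delta> * C * exp (- C * \<rho> w)) *\<^sub>R G w)"
  have "C1_with_gradient (closure \<Omega>) \<Theta> D\<Theta>"
    unfolding C1_with_gradient_def
  proof (intro conjI ballI)
    have "continuous_on (closure \<Omega>) D\<phi>" "continuous_on (closure \<Omega>) G" "continuous_on (closure \<Omega>) \<rho>"
      using C1 C1_with_gradient_subset[OF \<rho>(1), of "closure \<Omega>"] C1_with_gradient_continuous_on
      by (auto simp: C1_with_gradient_def)
    then show "continuous_on (closure \<Omega>) D\<Theta>"
      unfolding D\<Theta>_def by (intro continuous_intros)
    fix w assume "w \<in> closure \<Omega>"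
    then have d: "(\<phi> has_derivative (\<lambda>h. h \<bullet> D\<phi> w)) (at w within closure \<Omega>)"
      "(\<rho> has_derivative (\<lambda>h. h \<bullet> G w)) (at w within closure \<Omega>)"
      using C1 C1_with_gradient_subset[OF \<rho>(1), of "closure \<Omega>"]
      by (auto simp: C1_with_gradient_def)
    have "((\<lambda>y. (y - x) \<bullet> (y - x)) has_derivative (\<lambda>h. h \<bullet> (2 *\<^sub>R (w - x)))) (at w within closure \<Omega>)"
      by (auto intro!: derivative_eq_intros simp: inner_commute fun_eq_iff)
    moreover have "((\<lambda>y. exp (- C * \<rho> y)) has_derivative
        (\<lambda>h. - C * (h \<bullet> G w) * exp (- C * \<rho> w))) (at w within closure \<Omega>)"
      by (intro has_derivative_exp has_derivative_mult_right d)
    ultimately have "(\<Theta> has_derivative (\<lambda>h. h \<bullet> D\<phi> w + h \<bullet> (2 *\<^sub>R (w - x))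
        + 2 * \<delta> * (- C * (h \<bullet> G w) * exp (- C * \<rho> w)) + 0)) (at w within closure \<Omega>)"
      unfolding \<Theta>_def \<theta>_def \<psi>_def
      by (intro has_derivative_add has_derivative_mult_right has_derivative_const d)
    then show "(\<Theta> has_derivative (\<lambda>h. h \<bullet> D\<Theta> w)) (at w within closure \<Omega>)"
      by (rule has_derivative_eq_rhs) (simp add: D\<Theta>_def fun_eq_iff inner_add_right inner_diff_right)
  qed
  moreover have "touches_from_above (closure \<Omega>) \<Theta> u y"
  proof -
    have "\<forall>\<^sub>F w in nhds y. w \<in> ball x R"
      using dy by (intro eventually_nhds_in_open) (auto simp: dist_commute)
    then have "\<forall>\<^sub>F w in nhds y. w \<in> closure \<Omega> \<longrightarrow> U w \<le> ereal (\<Theta> w)"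
    proof eventually_elim
      case (elim w)
      have "U w \<le> ereal (\<Theta> w)" if "w \<in> closure \<Omega>"
        using ymax[of w] that elim v(1)
        by (cases "U w") (auto simp: K_def f_def \<Theta>_def)
      then show ?case by blast
    qed
    then show ?thesis
      using v(1) by (simp add: touches_from_above_def eventually_inf_principal \<Theta>_def U_def)
  qed
  ultimately have "\<Theta> y + H (D\<Theta> y) \<le> 0"
    using le y\<Omega> unfolding viscosity_le_def by blast
  \<comment> \<open>Here \<open>\<Theta> y = v > \<theta> y - 2 * \<delta> \<ge> \<phi> y - 2 *
    \<delta>\<close>, and \<open>2 * \<delta> < e\<close>.\<close>
  then have "H (D\<Theta> y) \<le> - \<phi> y + e"
    using v_gt \<delta>(3) exp_pos inner_ge_zero[of "y - x"]
    unfolding \<Theta>_def \<theta>_def \<psi>_def by linarith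
  moreover have "- 2 * \<delta> * C * exp (- C * \<rho> y) \<le> 0"
    using \<delta>(1) C(1) by simp
  moreover have "dist y x < e" using dy R by simp
  ultimately show ?thesis using y\<Omega> unfolding D\<Theta>_def by blast
qed

lemma subsolution_nonincreasing_part:
  fixes \<Omega> :: "'a::euclidean_space set"
  assumes "open \<Omega>" and bd: "C1_boundary \<Omega>"
    and H: "continuous_on UNIV H" "coercive H" "quasi_convex H"
    and weak: "weakly_continuous_at_boundary \<Omega> u"
    and le: "viscosity_le \<Omega> (\<lambda>x. H) u \<Omega>"
  shows "viscosity_le \<Omega> (\<lambda>x. nonincreasing_part H (inward_unit_normal \<Omega> x)) u (frontier \<Omega>)"
  unfolding viscosity_le_def
proof (intro allI ballI impI)
  fix \<phi> D\<phi> x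
  assume x: "x \<in> frontier \<Omega>" and C1: "C1_with_gradient (closure \<Omega>) \<phi> D\<phi>"
    and t: "touches_from_above (closure \<Omega>) \<phi> u x"
  define n where "n = inward_unit_normal \<Omega> x"
  have n: "is_inward_unit_normal \<Omega> x n"
    unfolding n_def using inward_unit_normal[OF bd x] .
  then have n1: "norm n = 1" by (simp add: is_inward_unit_normal_def)
  obtain r c \<rho> G where r: "r > 0" "c > 0" and \<rho>: "C1_with_gradient UNIV \<rho> G" "G x = c *\<^sub>R n"
    "\<And>y. y \<in> ball x r \<Longrightarrow> y \<in> \<Omega> \<longleftrightarrow> 0 < \<rho> y"
    using boundary_defining_function[OF n x] by metis
  have xc: "x \<in> closure \<Omega>" using x by (simp add: frontier_def)
  have weak_x: "usc_envelope (closure \<Omega>) u x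
      = Limsup (at x within \<Omega>) (usc_envelope (closure \<Omega>) u)"
    using weak x by (simp add: weakly_continuous_at_boundary_def)
  define e where "e k = 1 / real (Suc k)" for k
  have e0: "e \<longlonglongrightarrow> 0"
    unfolding e_def using LIMSEQ_inverse_real_of_nat by (simp add: inverse_eq_divide)
  have "\<forall>k. \<exists>y s. y \<in> \<Omega> \<and> dist y x < e k \<and> s \<le> 0 \<and>
      H (D\<phi> y + 2 *\<^sub>R (y - x) + s *\<^sub>R G y) \<le> - \<phi> y + e k"
    using penalized_interior_point[OF assms(1) x weak_x le C1 t r(1) \<rho>(1,3)]
    by (simp add: e_def)
  then obtain y s where ys: "\<And>k. y k \<in> \<Omega>" "\<And>k. dist (y k) x < e k" "\<And>k. s k \<le> 0"
    "\<And>k. H (D\<phi> (y k) + 2 *\<^sub>R (y k - x) + s k *\<^sub>R G (y k)) \<le> - \<phi> (y k) + e k"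
    by metis
  have yc: "y k \<in> closure \<Omega>" for k using ys(1) closure_subset by blast
  have ylim: "y \<longlonglongrightarrow> x"
    using e0 by (rule metric_tendsto_imp_tendsto) (use ys(2) in \<open>auto simp: e_def less_imp_le\<close>)
  have \<phi>lim: "(\<lambda>k. - \<phi> (y k) + e k) \<longlonglongrightarrow> - \<phi> x + 0"
    using continuous_on_tendsto_compose[OF C1_with_gradient_continuous_on[OF C1] ylim xc] yc
    by (intro tendsto_intros e0) auto
  define a where "a k = D\<phi> (y k) + 2 *\<^sub>R (y k - x)" for k
  define g where "g k = G (y k)" for k
  define z where "z k = a k + s k *\<^sub>R g k" for k
  have "(\<lambda>k. D\<phi> (y k)) \<longlonglongrightarrow> D\<phi> x"
    using C1 yc by (intro continuous_on_tendsto_compose[OF _ ylim xc]) (auto simp: C1_with_gradient_def)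
  then have "a \<longlonglongrightarrow> D\<phi> x + 2 *\<^sub>R (x - x)"
    unfolding a_def by (intro tendsto_intros ylim)
  then have alim: "a \<longlonglongrightarrow> D\<phi> x" by simp
  have glim: "g \<longlonglongrightarrow> c *\<^sub>R n"
    using \<rho>(1) unfolding g_def \<rho>(2)[symmetric] C1_with_gradient_def
    by (intro continuous_on_tendsto_compose[of UNIV G, OF _ ylim]) auto
  have Hz: "H (z k) \<le> - \<phi> (y k) + e k" for k
    using ys(4) by (simp add: z_def a_def g_def)
  \<comment> \<open>The upper bounds on \<open>H (z k)\<close> converge, so all \<open>z k\<close>
    lie in one sublevel set of \<open>H\<close>, bounded by coercivity.\<close>
  have "bounded (range z)"
  proof -
    obtain M where M: "\<And>k. norm (- \<phi> (y k) + e k) \<le> M"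
      using convergentI[OF \<phi>lim, THEN convergent_imp_Bseq] unfolding Bseq_def by blast
    have "\<forall>\<^sub>F q in at_infinity. M < H q"
      using H(2) unfolding coercive_def filterlim_at_top_dense by blast
    then obtain b where b: "\<And>q. b \<le> norm q \<Longrightarrow> M < H q"
      unfolding eventually_at_infinity by blast
    have "norm (z k) \<le> b" for k
      using b[of "z k"] Hz[of k] M[of k] by force
    then show ?thesis by (auto simp: bounded_iff)
  qed
  then obtain l \<sigma> where \<sigma>: "strict_mono \<sigma>" and zl: "(z \<circ> \<sigma>) \<longlonglongrightarrow> l"
    using bounded_imp_convergent_subsequence by blast
  have a\<sigma>: "(a \<circ> \<sigma>) \<longlonglongrightarrow> D\<phi> x" and g\<sigma>: "(g \<circ> \<sigma>) \<longlonglongrightarrow> c *\<^sub>R n"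
    using alim glim \<sigma> by (auto intro: LIMSEQ_subseq_LIMSEQ)
  \<comment> \<open>\<open>s k\<close> is the coefficient of \<open>z k - a k\<close> along
    \<open>g k\<close>. Since \<open>g\<close> has a nonzero limit, convergence of the vectors along
    \<open>\<sigma>\<close> forces the multipliers to converge, with limit \<open>t\<close>.\<close>
  define t where "t = ((l - D\<phi> x) \<bullet> (c *\<^sub>R n)) / ((c *\<^sub>R n) \<bullet> (c *\<^sub>R n))"
  have nz: "c *\<^sub>R n \<noteq> 0" using r n1 by auto
  have "(\<lambda>k. (((z \<circ> \<sigma>) k - (a \<circ> \<sigma>) k) \<bullet> (g \<circ> \<sigma>) k) / ((g \<circ> \<sigma>) k \<bullet> (g \<circ> \<sigma>) k)) \<longlonglongrightarrow> t"
    unfolding t_def using nz by (intro tendsto_intros zl a\<sigma> g\<sigma>) simp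
  moreover have "\<forall>\<^sub>F k in sequentially.
      (((z \<circ> \<sigma>) k - (a \<circ> \<sigma>) k) \<bullet> (g \<circ> \<sigma>) k) / ((g \<circ> \<sigma>) k \<bullet> (g \<circ> \<sigma>) k) = (s \<circ> \<sigma>) k"
    using tendsto_imp_eventually_ne[OF g\<sigma> nz]
    by eventually_elim (simp add: z_def)
  ultimately have slim: "(s \<circ> \<sigma>) \<longlonglongrightarrow> t"
    by (rule Lim_transform_eventually)
  then have t0: "t \<le> 0"
    by (rule LIMSEQ_le_const2) (use ys(3) in auto)
  have "(\<lambda>k. (a \<circ> \<sigma>) k + (s \<circ> \<sigma>) k *\<^sub>R (g \<circ> \<sigma>) k) \<longlonglongrightarrow> D\<phi> x + t *\<^sub>R c *\<^sub>R n"
    by (intro tendsto_intros a\<sigma> slim g\<sigma>)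
  then have "(\<lambda>k. H (z (\<sigma> k))) \<longlonglongrightarrow> H (D\<phi> x + (t * c) *\<^sub>R n)"
    by (intro continuous_on_tendsto_compose[OF H(1)]) (auto simp: z_def)
  moreover have "(\<lambda>k. - \<phi> (y (\<sigma> k)) + e (\<sigma> k)) \<longlonglongrightarrow> - \<phi> x + 0"
    using LIMSEQ_subseq_LIMSEQ[OF \<phi>lim \<sigma>] by (simp add: o_def)
  ultimately have "H (D\<phi> x + (t * c) *\<^sub>R n) \<le> - \<phi> x + 0"
    by (rule LIMSEQ_le) (use Hz in blast)
  \<comment> \<open>A single shift \<open>t * c \<le> 0\<close> suffices, because
    \<open>nonincreasing_part\<close> lies below \<open>H\<close> at every nonpositive
    shift.\<close>
  moreover have "nonincreasing_part H n (D\<phi> x) \<le> H (D\<phi> x + (t * c) *\<^sub>R n)"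
    using t0 r by (intro nonincreasing_part_le_shift[OF H n1]) (simp add: mult_nonpos_nonneg)
  ultimately show "\<phi> x + nonincreasing_part H (inward_unit_normal \<Omega> x) (D\<phi> x) \<le> 0"
    by (simp add: n_def)
qed

theorem theorem1p3:
  fixes \<Omega> :: "'a::euclidean_space set"
    and H :: "'a \<Rightarrow> real"
    and u :: "'a \<Rightarrow> real"
  assumes "open \<Omega>" and "bounded \<Omega>" and "C1_boundary \<Omega>"
    and "continuous_on UNIV H" and "coercive H" and "quasi_convex H"
    and "locally_bounded_on (closure \<Omega>) u"
    and "weakly_continuous_at_boundary \<Omega> u"
  shows "state_constraint_solution \<Omega> H u \<longleftrightarrow> flux_limited_solution \<Omega> H u"
proof
  assume sc: "state_constraint_solution \<Omega> H u"
  then have ge: "viscosity_ge \<Omega> (\<lambda>x. H) u (closure \<Omega>)" and le: "viscosity_le \<Omega> (\<lambda>x. H) u \<Omega>"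
    by (simp_all add: state_constraint_solution_def)
  have "viscosity_ge \<Omega> (\<lambda>x. H) u \<Omega>"
    using ge closure_subset unfolding viscosity_ge_def by blast
  with le show "flux_limited_solution \<Omega> H u"
    using assms supersolution_nonincreasing_part[OF _ ge] subsolution_nonincreasing_part[OF _ _ _ _ _ _ le]
    by (simp add: flux_limited_solution_def viscosity_eq_def)
next
  assume fl: "flux_limited_solution \<Omega> H u"
  then have ge: "viscosity_ge \<Omega> (\<lambda>x. H) u \<Omega>" and le: "viscosity_le \<Omega> (\<lambda>x. H) u \<Omega>"
    and ge': "viscosity_ge \<Omega> (\<lambda>x. nonincreasing_part H (inward_unit_normal \<Omega> x)) u (frontier \<Omega>)"
    by (simp_all add: flux_limited_solution_def viscosity_eq_def)
  \<comment> \<open>The shift 0 gives \<open>nonincreasing_part \<le> H\<close>, so the boundary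
    supersolution inequality passes to \<open>H\<close> with the same test function.\<close>
  have "viscosity_ge \<Omega> (\<lambda>x. H) u (frontier \<Omega>)"
    unfolding viscosity_ge_def
  proof (intro allI ballI impI)
    fix \<phi> D\<phi> x
    assume x: "x \<in> frontier \<Omega>" and C1: "C1_with_gradient (closure \<Omega>) \<phi> D\<phi>"
      and t: "touches_from_below (closure \<Omega>) \<phi> u x"
    have n: "norm (inward_unit_normal \<Omega> x) = 1"
      using inward_unit_normal[OF assms(3) x] by (simp add: is_inward_unit_normal_def)
    have "nonincreasing_part H (inward_unit_normal \<Omega> x) (D\<phi> x) \<le> H (D\<phi> x)"
      using nonincreasing_part_le_shift[OF assms(4-6) n, of 0] by simp
    then show "0 \<le> \<phi> x + H (D\<phi> x)"
      using ge' x C1 t unfolding viscosity_ge_def by force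
  qed
  moreover have "closure \<Omega> = \<Omega> \<union> frontier \<Omega>"
    using assms(1) closure_Un_frontier by blast
  ultimately show "state_constraint_solution \<Omega> H u"
    using ge le unfolding state_constraint_solution_def viscosity_ge_def by blast
qed

end
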